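(* Let $(X,d)$ be a complete separable metric space and let $\mathfrak m$ be a Borel, locally finite, non-negative measure on $X$ with $\operatorname{supp}\mathfrak m=X$. Let $p,q\in X$. (i) If $(X,d,\mathfrak m)$ is Lipschitz-infinitesimally strictly convex then, for $\mathfrak m$-a.e. $x\in X$, the angle cones $\boldsymbol{\angle}_{pxq}$ and $\boldsymbol{\angle}_{qxp}$ are single valued, i.e. $$\boldsymbol{\angle}_{pxq}=\{\angle_{pxq}\},\qquad \boldsymbol{\angle}_{qxp}=\{\angle_{qxp}\}$$ for some numbers $\angle_{pxq},\angle_{qxp}\in[0,\pi]$. (ii) If moreover $(X,d,\mathfrak m)$ is Lipschitz-infinitesimally Hilbertian then, for $\mathfrak m$-a.e. $x\in X$, the angle cones $\boldsymbol{\angle}_{pxq}$ and $\boldsymbol{\angle}_{qxp}$ are not only single valued but also coincide, i.e. $$\boldsymbol{\angle}_{pxq}=\{\angle_{pxq}\}=\{\angle_{qxp}\}=\boldsymbol{\angle}_{qxp}.$$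
   Context: Locally finite means that every $x\in X$ has a neighborhood of finite $\mathfrak m$-measure; $\operatorname{supp}\mathfrak m$ is the smallest closed set on which $\mathfrak m$ is concentrated. Slope: for $f:X\to\mathbb R$, $|Df|(x):=\limsup_{y\to x}\frac{|f(y)-f(x)|}{d(y,x)}$ if $x$ is not isolated, and $|Df|(x):=0$ if $x$ is isolated. For $f,g:X\to\mathbb R$ with finite slopes, the functions $D^{\pm}f(\nabla g):X\to\mathbb R$ are defined pointwise by $$D^{+}f(\nabla g):=\liminf_{\varepsilon\downarrow0}\frac{|D(g+\varepsilon f)|^2-|Dg|^2}{2\varepsilon},\qquad D^{-}f(\nabla g):=\limsup_{\varepsilon\uparrow0}\frac{|D(g+\varepsilon f)|^2-|Dg|^2}{2\varepsilon}$$ on $\{|Dg|\neq0\}$, and are $0$ by definition on $\{|Dg|=0\}$. Angle cone: for $p,x,q\in X$ let $r_p:=d(p,\cdot)$, $r_q:=d(q,\cdot)$, $c^{\pm}_{pxq}:=D^{\pm}r_p(\nabla r_q)(x)$ (these lie in $[-1,1]$ and $c^-_{pxq}\le c^+_{pxq}$), $\angle^-_{pxq}:=\arccos c^+_{pxq}$, $\angle^+_{pxq}:=\arccos c^-_{pxq}$. The angle cone of $(p,x,q)$ is the interval $\boldsymbol{\angle}_{pxq}:=[\angle^-_{pxq},\angle^+_{pxq}]\subset[0,\pi]$. It is single valued if it consists of one number. Let $\mathrm{LIP}(X)$ be the space of real-valued Lipschitz functions on $X$. $(X,d,\mathfrak m)$ is Lipschitz-infinitesimally strictly convex if for every $f,g\in\mathrm{LIP}(X)$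 one has $D^+f(\nabla g)=D^-f(\nabla g)$ $\mathfrak m$-a.e. in $X$. It is Lipschitz-infinitesimally Hilbertian if for every $f,g\in\mathrm{LIP}(X)$ one has $D^+f(\nabla g)=D^-f(\nabla g)=D^-g(\nabla f)=D^+g(\nabla f)$ $\mathfrak m$-a.e. in $X$. *)

theory Defs
  imports "HOL-Analysis.Analysis"
begin

definition locally_finite_measure :: "'a::topological_space measure \<Rightarrow> bool" where
  "locally_finite_measure m \<longleftrightarrow> (\<forall>x. \<exists>U. open U \<and> x \<in> U \<and> emeasure m U < \<infinity>)"

(* In a second countable space this intersection is itself the complement of a null set,
   so it is the smallest closed set on which m is concentrated. *)
definition measure_support :: "'a::topological_space measure \<Rightarrow> 'a set" where
  "measure_support m = \<Inter>{C. closed C \<and> emeasure m (- C) = 0}"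

(* The case distinction is needed: at an isolated point the filter "at x" is bot,
   and the Limsup along it would be -\<infinity>. *)
definition slope :: "('a::metric_space \<Rightarrow> real) \<Rightarrow> 'a \<Rightarrow> ereal" where
  "slope f x =
     (if x isolated_in UNIV then 0
      else Limsup (at x) (\<lambda>y. ereal (\<bar>f y - f x\<bar> / dist y x)))"

(* D_plus f g x and D_minus f g x stand for D^+ f(grad g)(x) and D^- f(grad g)(x).
   They are meant for f, g with finite slopes; then the quotients are real numbers, bounded as
   epsilon tends to 0 since |D(g + epsilon f)| differs from |Dg| by at most |epsilon| |Df|,
   and both values are finite. *)
definition D_plus :: "('a::metric_space \<Rightarrow> real) \<Rightarrow> ('a \<Rightarrow> real) \<Rightarrow> 'a \<Rightarrow> ereal" where
  "D_plus f g x =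
     (if slope g x = 0 then 0
      else Liminf (at_right 0)
        (\<lambda>\<epsilon>::real. ((slope (\<lambda>y. g y + \<epsilon> * f y) x)\<^sup>2 - (slope g x)\<^sup>2) / ereal (2 * \<epsilon>)))"

definition D_minus :: "('a::metric_space \<Rightarrow> real) \<Rightarrow> ('a \<Rightarrow> real) \<Rightarrow> 'a \<Rightarrow> ereal" where
  "D_minus f g x =
     (if slope g x = 0 then 0
      else Limsup (at_left 0)
        (\<lambda>\<epsilon>::real. ((slope (\<lambda>y. g y + \<epsilon> * f y) x)\<^sup>2 - (slope g x)\<^sup>2) / ereal (2 * \<epsilon>)))"

(* The distance functions are 1-Lipschitz, so the values of D_plus and D_minus below are finite
   and passing to real loses nothing. *)
definition c_plus :: "'a::metric_space \<Rightarrow> 'a \<Rightarrow> 'a \<Rightarrow> real" where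
  "c_plus p x q = real_of_ereal (D_plus (\<lambda>y. dist p y) (\<lambda>y. dist q y) x)"

definition c_minus :: "'a::metric_space \<Rightarrow> 'a \<Rightarrow> 'a \<Rightarrow> real" where
  "c_minus p x q = real_of_ereal (D_minus (\<lambda>y. dist p y) (\<lambda>y. dist q y) x)"

(* arccos is decreasing: the lower angle comes from c_plus, the upper one from c_minus. *)
definition angle_minus :: "'a::metric_space \<Rightarrow> 'a \<Rightarrow> 'a \<Rightarrow> real" where
  "angle_minus p x q = arccos (c_plus p x q)"

definition angle_plus :: "'a::metric_space \<Rightarrow> 'a \<Rightarrow> 'a \<Rightarrow> real" where
  "angle_plus p x q = arccos (c_minus p x q)"

definition angle_cone :: "'a::metric_space \<Rightarrow> 'a \<Rightarrow> 'a \<Rightarrow> real set" where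
  "angle_cone p x q = {angle_minus p x q .. angle_plus p x q}"

definition LIP :: "('a::metric_space \<Rightarrow> real) set" where
  "LIP = {f. \<exists>L. L-lipschitz_on UNIV f}"

definition lip_inf_strictly_convex :: "'a::metric_space measure \<Rightarrow> bool" where
  "lip_inf_strictly_convex m \<longleftrightarrow>
     (\<forall>f\<in>LIP. \<forall>g\<in>LIP. AE x in m. D_plus f g x = D_minus f g x)"

definition lip_inf_hilbertian :: "'a::metric_space measure \<Rightarrow> bool" where
  "lip_inf_hilbertian m \<longleftrightarrow>
     (\<forall>f\<in>LIP. \<forall>g\<in>LIP. AE x in m.
        D_plus f g x = D_minus f g x \<and>
        D_minus f g x = D_minus g f x \<and>
        D_minus g f x = D_plus g f x)"

end

(* Since the slope is subadditive and at most the Lipschitz constant, for K-Lipschitz f and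
   L-Lipschitz g the difference quotients defining D_plus f g and D_minus f g are bounded by
   K L + K^2 |eps| / 2.  Distance functions being 1-Lipschitz, c_plus and c_minus lie in [-1,1],
   where arccos takes values in [0,pi].  The rest is the definition of the two geometric
   conditions applied to the distance functions from p and q. *)
theory Submission
  imports Defs
begin

lemma isolated_in_UNIV_iff: "x isolated_in UNIV \<longleftrightarrow> at x = bot"
  for x :: "'a::metric_space"
  by (simp add: isolated_in_islimpt_iff trivial_limit_within)

lemma slope_nonneg: "0 \<le> slope f x"
  unfolding slope_def isolated_in_UNIV_iff
  by (auto intro!: le_Limsup always_eventually)

text \<open>By the triangle inequality the difference quotient of the sum exceeds that of
  \<open>g\<close> by at most \<open>K\<close>, and adding a finite constant commutes with
  \<open>Limsup\<close>. Only \<open>h\<close> has to be Lipschitz; \<open>g\<close> is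
  arbitrary.\<close>

lemma slope_add_le:
  assumes "K-lipschitz_on UNIV h"
  shows "slope (\<lambda>y. g y + h y) x \<le> slope g x + ereal K"
proof (cases "at x = bot")
  case True
  \<comment> \<open>At an isolated point both slopes are 0 by convention, so only 0 \<le>
    \<open>K\<close> remains.\<close>
  then show ?thesis
    using lipschitz_on_nonneg[OF assms] by (simp add: slope_def isolated_in_UNIV_iff)
next
  case False
  have "\<bar>g y + h y - (g x + h x)\<bar> / dist y x \<le> \<bar>g y - g x\<bar> / dist y x + K" if "y \<noteq> x" for y
  proof -
    have "\<bar>h y - h x\<bar> \<le> K * dist y x"
      using lipschitz_onD[OF assms, of y x] by (simp add: dist_real_def)
    then have "\<bar>g y + h y - (g x + h x)\<bar> \<le> \<bar>g y - g x\<bar> + K * dist y x"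
      by linarith
    then show ?thesis
      using that by (simp add: field_simps)
  qed
  then have "slope (\<lambda>y. g y + h y) x \<le> Limsup (at x) (\<lambda>y. ereal (\<bar>g y - g x\<bar> / dist y x) + ereal K)"
    using False unfolding slope_def isolated_in_UNIV_iff
    by (auto intro!: Limsup_mono simp: eventually_at_filter)
  also have "\<dots> = slope g x + ereal K"
    using False unfolding slope_def isolated_in_UNIV_iff
    by (subst Limsup_add_ereal_right) auto
  finally show ?thesis .
qed

text \<open>This is \<open>slope_add_le\<close> for a perturbation of the zero function, whose slope
  vanishes.\<close>

lemma slope_le_lipschitz:
  assumes "K-lipschitz_on UNIV f"
  shows "slope f x \<le> ereal K"
proof -
  have "slope (\<lambda>_. 0) x \<le> 0"
    unfolding slope_def by (auto intro!: Limsup_bounded)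
  then show ?thesis
    using slope_add_le[OF assms, of "\<lambda>_. 0" x] slope_nonneg[of "\<lambda>_. 0" x] by (simp add: order_antisym)
qed

text \<open>With s and t the slopes of the perturbed and the original function, factor s^2 - t^2 =
  (s - t)(s + t): the first factor is of order \<epsilon> and cancels the denominator, the second
  stays close to 2t.\<close>

lemma slope_quotient_bound:
  fixes f g :: "'a::metric_space \<Rightarrow> real"
  assumes f: "K-lipschitz_on UNIV f" and g: "L-lipschitz_on UNIV g" and "\<epsilon> \<noteq> 0"
  shows "\<bar>((slope (\<lambda>y. g y + \<epsilon> * f y) x)\<^sup>2 - (slope g x)\<^sup>2) / ereal (2 * \<epsilon>)\<bar>
           \<le> ereal (K * L + K\<^sup>2 * \<bar>\<epsilon>\<bar> / 2)"
proof -
  \<comment> \<open>Lipschitz functions have finite slopes, so the extended-real quotient reduces to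
    real arithmetic.\<close>
  have real_slope: "\<exists>r. slope h x = ereal r \<and> 0 \<le> r \<and> r \<le> M" if "M-lipschitz_on UNIV h" for h M
    using slope_le_lipschitz[OF that, of x] slope_nonneg[of h x] by (cases "slope h x") auto
  have K: "0 \<le> K"
    using f lipschitz_on_nonneg by blast
  have h: "(\<bar>\<epsilon>\<bar> * K)-lipschitz_on UNIV (\<lambda>y. \<epsilon> * f y)"
    using lipschitz_on_cmult_real[OF f] by simp
  \<comment> \<open>Adding \<open>- (\<epsilon> * f y)\<close> to the perturbed function gives back
    \<open>g\<close>; this yields the reverse estimate of t by s.\<close>
  have h': "(\<bar>\<epsilon>\<bar> * K)-lipschitz_on UNIV (\<lambda>y. - (\<epsilon> * f y))"
    using h by simp
  obtain t where t: "slope g x = ereal t" "0 \<le> t" "t \<le> L"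
    using real_slope[OF g] by blast
  obtain s where s: "slope (\<lambda>y. g y + \<epsilon> * f y) x = ereal s" "0 \<le> s"
    using real_slope[OF lipschitz_on_add[OF g h]] by blast
  have "s \<le> t + \<bar>\<epsilon>\<bar> * K"
    using slope_add_le[OF h, of g x] s t by simp
  moreover have "t \<le> s + \<bar>\<epsilon>\<bar> * K"
    using slope_add_le[OF h', of "\<lambda>y. g y + \<epsilon> * f y" x] s t by simp
  ultimately have "\<bar>s - t\<bar> \<le> \<bar>\<epsilon>\<bar> * K" "s + t \<le> 2 * L + \<bar>\<epsilon>\<bar> * K"
    using t by auto
  then have "\<bar>s - t\<bar> * (s + t) \<le> (\<bar>\<epsilon>\<bar> * K) * (2 * L + \<bar>\<epsilon>\<bar> * K)"
    using s t K by (intro mult_mono) auto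
  moreover have "\<bar>s - t\<bar> * (s + t) = \<bar>s\<^sup>2 - t\<^sup>2\<bar>"
    using s t by (simp add: power2_eq_square square_diff_square_factored abs_mult mult.commute)
  ultimately have "\<bar>s\<^sup>2 - t\<^sup>2\<bar> / (2 * \<bar>\<epsilon>\<bar>) \<le> (\<bar>\<epsilon>\<bar> * K) * (2 * L + \<bar>\<epsilon>\<bar> * K) / (2 * \<bar>\<epsilon>\<bar>)"
    by (intro divide_right_mono) auto
  also have "\<dots> = K * L + K\<^sup>2 * \<bar>\<epsilon>\<bar> / 2"
    using \<open>\<epsilon> \<noteq> 0\<close> by (simp add: field_simps power2_eq_square)
  finally show ?thesis
    using \<open>\<epsilon> \<noteq> 0\<close> by (simp add: s t abs_mult)
qed

text \<open>The term of the quotient bound that depends on \<epsilon> vanishes as \<epsilon> tends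
  to 0. \<open>F \<le> at 0\<close> keeps \<epsilon> away from 0, and \<open>F \<noteq> bot\<close>
  makes the \<open>Liminf\<close> and \<open>Limsup\<close> of a convergent function equal to its
  limit.\<close>

lemma slope_quotient_limits_bound:
  fixes f g :: "'a::metric_space \<Rightarrow> real"
  defines "Q x \<equiv> \<lambda>\<epsilon>. ((slope (\<lambda>y. g y + \<epsilon> * f y) x)\<^sup>2 - (slope g x)\<^sup>2) / ereal (2 * \<epsilon>)"
  assumes f: "K-lipschitz_on UNIV f" and g: "L-lipschitz_on UNIV g"
    and F: "F \<le> at 0" "F \<noteq> bot"
  shows "ereal (- (K * L)) \<le> Liminf F (Q x)" "Limsup F (Q x) \<le> ereal (K * L)"
proof -
  define B where "B \<equiv> \<lambda>\<epsilon>::real. K * L + K\<^sup>2 * \<bar>\<epsilon>\<bar> / 2"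
  have "\<forall>\<^sub>F \<epsilon> in at 0. \<epsilon> \<noteq> (0::real)"
    by (simp add: eventually_at_filter)
  then have "\<forall>\<^sub>F \<epsilon> in F. \<epsilon> \<noteq> 0"
    using F(1) filter_leD by blast
  then have Q: "\<forall>\<^sub>F \<epsilon> in F. \<bar>Q x \<epsilon>\<bar> \<le> ereal (B \<epsilon>)"
    unfolding Q_def B_def by (rule eventually_mono) (rule slope_quotient_bound[OF f g])
  have "B \<midarrow>0\<rightarrow> K * L"
    unfolding B_def by (auto intro!: tendsto_eq_intros)
  then have B: "(B \<longlongrightarrow> K * L) F"
    using F(1) tendsto_mono by blast
  have "ereal (- (K * L)) = Liminf F (\<lambda>\<epsilon>. ereal (- B \<epsilon>))"
    using B F(2) by (intro lim_imp_Liminf[symmetric]) (auto intro!: tendsto_intros)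
  also have "\<dots> \<le> Liminf F (Q x)"
    using Q
  proof (intro Liminf_mono, elim eventually_mono)
    fix \<epsilon> assume "\<bar>Q x \<epsilon>\<bar> \<le> ereal (B \<epsilon>)"
    then show "ereal (- B \<epsilon>) \<le> Q x \<epsilon>" by (cases "Q x \<epsilon>") auto
  qed
  finally show "ereal (- (K * L)) \<le> Liminf F (Q x)" .
  have "Limsup F (Q x) \<le> Limsup F (\<lambda>\<epsilon>. ereal (B \<epsilon>))"
    using Q
  proof (intro Limsup_mono, elim eventually_mono)
    fix \<epsilon> assume "\<bar>Q x \<epsilon>\<bar> \<le> ereal (B \<epsilon>)"
    then show "Q x \<epsilon> \<le> ereal (B \<epsilon>)" by (cases "Q x \<epsilon>") auto
  qed
  also have "\<dots> = ereal (K * L)"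
    using B F(2) by (intro lim_imp_Limsup) (auto intro!: tendsto_intros)
  finally show "Limsup F (Q x) \<le> ereal (K * L)" .
qed

text \<open>Bounding \<open>D_plus\<close> suffices for the angles: where the cone is a single
  point, that point is \<open>angle_minus\<close>, which is computed from
  \<open>D_plus\<close>.\<close>

lemma D_plus_bound:
  assumes "K-lipschitz_on UNIV f" "L-lipschitz_on UNIV g"
  shows "\<bar>D_plus f g x\<bar> \<le> ereal (K * L)"
proof (cases "slope g x = 0")
  case True
  then show ?thesis
    using assms[THEN lipschitz_on_nonneg] by (simp add: D_plus_def)
next
  case False
  have le: "at_right (0::real) \<le> at 0"
    by (simp add: at_le)
  have nb: "at_right (0::real) \<noteq> bot"
    by simp
  note lim = slope_quotient_limits_bound[OF assms le nb, of x]
  \<comment> \<open>The upper bound is known for the \<open>Limsup\<close> and passes to the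
    \<open>Liminf\<close> because the filter is nontrivial.\<close>
  have "ereal (- (K * L)) \<le> D_plus f g x" "D_plus f g x \<le> ereal (K * L)"
    using False lim(1) order_trans[OF Liminf_le_Limsup[OF nb] lim(2)] by (simp_all add: D_plus_def)
  then show ?thesis
    by (cases "D_plus f g x") auto
qed

lemma lipschitz_on_dist: "1-lipschitz_on UNIV (\<lambda>y. dist p y)"
proof (rule lipschitz_onI)
  show "dist (dist p y) (dist p z) \<le> 1 * dist y z" for y z
    using abs_dist_diff_le[of y p z] by (simp add: dist_real_def dist_commute[of p y])
qed simp

lemma dist_in_LIP: "(\<lambda>y. dist p y) \<in> LIP"
  unfolding LIP_def using lipschitz_on_dist by blast

lemma angle_minus_bounds: "angle_minus p x q \<in> {0..pi}"
proof -
  have "\<bar>D_plus (\<lambda>y. dist p y) (\<lambda>y. dist q y) x\<bar> \<le> ereal 1"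
    using D_plus_bound[OF lipschitz_on_dist lipschitz_on_dist, of p q x] by simp
  then have "-1 \<le> c_plus p x q" "c_plus p x q \<le> 1"
    unfolding c_plus_def
    by (cases "D_plus (\<lambda>y. dist p y) (\<lambda>y. dist q y) x"; auto)+
  then show ?thesis
    by (simp add: angle_minus_def arccos_lbound arccos_ubound)
qed

text \<open>The hypothesis gives \<open>c_plus\<close> = \<open>c_minus\<close>, so the two
  endpoints of the interval agree.\<close>

lemma angle_cone_single_valued:
  assumes "D_plus (\<lambda>y. dist p y) (\<lambda>y. dist q y) x = D_minus (\<lambda>y. dist p y) (\<lambda>y. dist q y) x"
  shows "angle_cone p x q = {angle_minus p x q}"
  using assms
  by (simp add: angle_cone_def angle_minus_def angle_plus_def c_plus_def c_minus_def)

theorem theorem3p5: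
  fixes m :: "'a::polish_space measure" and p q :: 'a
  assumes "sets m = sets borel"
    and "locally_finite_measure m"
    and "measure_support m = UNIV"
  shows "(lip_inf_strictly_convex m \<longrightarrow>
            (AE x in m. \<exists>\<alpha>\<in>{0..pi}. \<exists>\<beta>\<in>{0..pi}.
               angle_cone p x q = {\<alpha>} \<and> angle_cone q x p = {\<beta>})) \<and>
         (lip_inf_hilbertian m \<longrightarrow>
            (AE x in m. \<exists>\<alpha>\<in>{0..pi}.
               angle_cone p x q = {\<alpha>} \<and> angle_cone q x p = {\<alpha>}))"
proof (intro conjI impI)
  assume "lip_inf_strictly_convex m"
  \<comment> \<open>Stated for arbitrary a, b since \<open>D_plus\<close> and \<open>D_minus\<close>
    are not symmetric: the pairs (p, q) and (q, p) give two exceptional null sets, whose union is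
    discarded.\<close>
  then have "AE x in m. D_plus (\<lambda>y. dist a y) (\<lambda>y. dist b y) x
      = D_minus (\<lambda>y. dist a y) (\<lambda>y. dist b y) x" for a b :: 'a
    using dist_in_LIP unfolding lip_inf_strictly_convex_def by blast
  from this[of p q] this[of q p]
  show "AE x in m. \<exists>\<alpha>\<in>{0..pi}. \<exists>\<beta>\<in>{0..pi}.
      angle_cone p x q = {\<alpha>} \<and> angle_cone q x p = {\<beta>}"
    by eventually_elim (meson angle_cone_single_valued angle_minus_bounds)
next
  assume "lip_inf_hilbertian m"
  \<comment> \<open>One instance serves both cones: the outer equalities make each cone a single
    point, and the middle one links the two orders.\<close>
  then have "AE x in m.
      D_plus (\<lambda>y. dist p y) (\<lambda>y. dist q y) x = D_minus (\<lambda>y. dist p y) (\<lambda>y. dist q y) x \<and>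
      D_minus (\<lambda>y. dist p y) (\<lambda>y. dist q y) x = D_minus (\<lambda>y. dist q y) (\<lambda>y. dist p y) x \<and>
      D_minus (\<lambda>y. dist q y) (\<lambda>y. dist p y) x = D_plus (\<lambda>y. dist q y) (\<lambda>y. dist p y) x"
    using dist_in_LIP unfolding lip_inf_hilbertian_def by blast
  then show "AE x in m. \<exists>\<alpha>\<in>{0..pi}. angle_cone p x q = {\<alpha>} \<and> angle_cone q x p = {\<alpha>}"
  proof eventually_elim
    case (elim x)
    \<comment> \<open>The chain of equalities identifies \<open>D_plus\<close> for the two orders,
      so \<open>angle_minus p x q\<close> is the common witness.\<close>
    then have "angle_minus q x p = angle_minus p x q"
      by (simp add: angle_minus_def c_plus_def)
    then show ?case
      using elim angle_cone_single_valued[of p q x] angle_cone_single_valued[of q p x]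
        angle_minus_bounds[of p x q] by auto
  qed
qed

end
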